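(* Let $n_0\ge0$, $n_1\ge1$ and $k\ge1$ be integers, $n=n_0+n_1$, and $$D_1(n_1;n_0;0,0,k;q):=\mathrm{CT}\bigg(\prod_{n_0+1\le i<j\le n}(z_i-q^{k+1}z_j)(z_i^{-1}-q^kz_j^{-1})\prod_{1\le i<j\le n}\Big(\frac{z_i}{z_j};q\Big)_k\Big(q\frac{z_j}{z_i};q\Big)_k\bigg).$$ Then $$D_1(n_1;n_0;0,0,k;q)=\frac{\Gamma_{q^{k+1}}(n_1+1)}{(\Gamma_q(1+k))^n}\prod_{j=0}^{n_1-1}\frac{\Gamma_q((k+1)(j+1)+kn_0)}{\Gamma_q((k+1)j+kn_0+1)}\ \prod_{l=0}^{n_0-1}\frac{\Gamma_q(1+k(l+1))}{\Gamma_q(1+kl)}.$$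
   Context: $\mathrm{CT}$ denotes the constant term of a Laurent polynomial with respect to $z=(z_1,\dots,z_n)$, $q$ is an indeterminate, and $(a;q)_k:=\prod_{m=0}^{k-1}(1-aq^m)$. $\Gamma_q$ is the $q$-gamma function; it is only needed at positive integers, where $\Gamma_q(1+m)=[m]_q!=[1]_q[2]_q\cdots[m]_q$ with $[m]_q=(1-q^m)/(1-q)$. *)

theory Defs
  imports
    "HOL-Library.Poly_Mapping"
    "HOL-Computational_Algebra.Polynomial"
    "HOL-Computational_Algebra.Fraction_Field"
begin

type_synonym ratfun = "rat poly fract"

definition q_indet :: ratfun where
  "q_indet = Fract [:0, 1:] 1"

text \<open>
  Laurent polynomials form the group algebra, over the field of rational functions in the
  indeterminate \<open>q\<close>, of the finitely supported exponent vectors \<open>nat \<Rightarrow>\<^sub>0 int\<close>; multiplication is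
  the convolution product of finitely supported functions. There are countably many
  variables \<open>z i\<close>, of which a given expression involves only finitely many.
\<close>

type_synonym laurent = "(nat \<Rightarrow>\<^sub>0 int) \<Rightarrow>\<^sub>0 ratfun"

definition lconst :: "ratfun \<Rightarrow> laurent" where
  "lconst c = Poly_Mapping.single 0 c"

definition lz :: "nat \<Rightarrow> laurent" where
  "lz i = Poly_Mapping.single (Poly_Mapping.single i 1) 1"

definition lz_inv :: "nat \<Rightarrow> laurent" where
  "lz_inv i = Poly_Mapping.single (Poly_Mapping.single i (- 1)) 1"

lemma lz_mult_lz_inv: "lz i * lz_inv i = 1"
  by (simp add: lz_def lz_inv_def mult_single flip: single_add)

definition CT :: "laurent \<Rightarrow> ratfun" where
  "CT f = Poly_Mapping.lookup f 0"

definition q_poch :: "'a::comm_ring_1 \<Rightarrow> 'a \<Rightarrow> nat \<Rightarrow> 'a" where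
  "q_poch a q k = (\<Prod>m<k. 1 - a * q ^ m)"

definition q_bracket :: "'a::field \<Rightarrow> nat \<Rightarrow> 'a" where
  "q_bracket q m = (1 - q ^ m) / (1 - q)"

definition q_factorial :: "'a::field \<Rightarrow> nat \<Rightarrow> 'a" where
  "q_factorial q m = (\<Prod>i=1..m. q_bracket q i)"

text \<open>
  The \<open>q\<close>-gamma function at positive integers, given by \<open>\<Gamma>\<^sub>q(1 + m) = [m]\<^sub>q!\<close>.
  The value at \<open>0\<close>, where \<open>\<Gamma>\<^sub>q\<close> has a pole, carries no meaning.
\<close>

definition q_Gamma :: "'a::field \<Rightarrow> nat \<Rightarrow> 'a" where
  "q_Gamma q x = q_factorial q (x - 1)"

lemma q_Gamma_one_plus: "q_Gamma q (1 + m) = q_factorial q m"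
  by (simp add: q_Gamma_def)

text \<open>The constant term \<open>D\<^sub>1(n\<^sub>1; n\<^sub>0; a, b, k; q)\<close> in the case \<open>a = b = 0\<close>.\<close>

definition D1_00 :: "nat \<Rightarrow> nat \<Rightarrow> nat \<Rightarrow> ratfun" where
  "D1_00 n1 n0 k =
    (let n = n0 + n1; q = lconst q_indet in
     CT ((\<Prod>(i, j) \<in> {(i, j). n0 + 1 \<le> i \<and> i < j \<and> j \<le> n}.
            (lz i - q ^ (k + 1) * lz j) * (lz_inv i - q ^ k * lz_inv j)) *
         (\<Prod>(i, j) \<in> {(i, j). 1 \<le> i \<and> i < j \<and> j \<le> n}.
            q_poch (lz i * lz_inv j) q k * q_poch (q * (lz j * lz_inv i)) q k)))"

end

theory Submission
  imports Defs "HOL-Library.FuncSet"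
begin

text \<open>
  The two products combine to the constant term of
  \<open>\<Prod>\<^bsub>i<j\<^esub> (z\<^sub>i/z\<^sub>j;q)\<^sub>\<lambda> (q z\<^sub>j/z\<^sub>i;q)\<^sub>\<lambda>\<close>, where \<open>\<lambda> = k + 1\<close> if \<open>i > n\<^sub>0\<close> and \<open>\<lambda> = k\<close>
  otherwise. By Lagrange interpolation the constant term is a weighted sum of the values of this
  Laurent polynomial over a grid \<open>C\<^sub>1 \<times> \<dots> \<times> C\<^sub>n\<close> in which \<open>C\<^sub>i\<close> has one element more than the order
  of the pole in \<open>z\<^sub>i\<close>. Taking powers of \<open>q\<close> as nodes, a grid point with exponents \<open>\<alpha>\<^sub>i\<close>
  contributes only if the exponents are far apart: passing from one to the next larger costs at
  least \<open>k\<close>, and at least \<open>k + 1\<close> when the smaller one has index \<open>> n\<^sub>0\<close>. With \<open>M = (n - 1)k + n\<^sub>1 - 1\<close>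
  and exponents in \<open>{0..M}\<close>, the largest one therefore equals \<open>M\<close> and belongs to an index \<open>> n\<^sub>0\<close>,
  all steps are tight, and the largest exponent with index \<open>\<le> n\<^sub>0\<close> is \<open>(n\<^sub>0 - 1 + j)k + j\<close>,
  where \<open>j\<close> indices \<open>> n\<^sub>0\<close> precede it. The \<open>n\<^sub>1 - 1\<close> values with \<open>j > 0\<close> are exactly
  as many as can be left out of \<open>C\<^sub>i\<close> for \<open>i \<le> n\<^sub>0\<close>; after that a single grid point survives, and
  its contribution telescopes to the product formula.
\<close>

section \<open>Lagrange weights\<close>

text \<open>The polynomial of degree less than \<open>card Y\<close> that interpolates
  \<open>y ^ s\<close> on \<open>Y\<close> is the monomial itself; the claim compares the values at
  0.\<close>

lemma lagrange_power_at_0: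
  fixes Y :: "'a::field set"
  assumes fin: "finite Y" and s: "s < card Y"
  shows "(\<Sum>y\<in>Y. y ^ s * (\<Prod>x\<in>Y - {y}. x / (x - y))) = 0 ^ s"
proof -
  define L where "L y = (\<Prod>x\<in>Y - {y}. smult (inverse (x - y)) [:x, - 1:])" for y
  define p where "p = (\<Sum>y\<in>Y. smult (y ^ s) (L y))"
  have poly_L: "poly (L y) z = (\<Prod>x\<in>Y - {y}. (x - z) / (x - y))" for y z
    by (simp add: L_def poly_prod divide_inverse algebra_simps)
  have L_delta: "poly (L y) z = (if y = z then 1 else 0)" if "y \<in> Y" "z \<in> Y" for y z
    using that fin by (auto simp: poly_L intro!: prod.neutral)
  have deg_L: "degree (L y) < card Y" if "y \<in> Y" for y
  proof -
    have "degree (L y) \<le> (\<Sum>x\<in>Y - {y}. degree (smult (inverse (x - y)) [:x, - 1:]))"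
      unfolding L_def using degree_prod_sum_le[of "Y - {y}" "\<lambda>x. smult (inverse (x - y)) [:x, - 1:]"] fin
      by (simp add: o_def)
    also have "\<dots> \<le> (\<Sum>x\<in>Y - {y}. 1)"
      by (intro sum_mono) (simp add: degree_smult_le)
    also have "\<dots> < card Y"
      using that fin card_Diff1_less[of Y y] by simp
    finally show ?thesis .
  qed
  have "p = monom 1 s"
  proof (rule poly_eqI_degree[of Y])
    fix z assume z: "z \<in> Y"
    have "poly p z = (\<Sum>y\<in>Y. if y = z then y ^ s else 0)"
      unfolding p_def by (simp add: poly_sum) (intro sum.cong refl, simp add: L_delta z)
    then show "poly p z = poly (monom 1 s) z"
      using z fin by (simp add: poly_monom)
  next
    show "degree p < card Y"
      unfolding p_def using fin s
      by (intro degree_sum_less) (auto simp del: degree_smult_eq intro: le_less_trans[OF degree_smult_le] deg_L)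
  next
    show "degree (monom (1 :: 'a) s) < card Y"
      using s by (simp add: degree_monom_eq)
  qed
  then have "poly p 0 = 0 ^ s"
    by (simp add: poly_monom)
  then show ?thesis
    by (simp add: p_def poly_sum poly_L)
qed

text \<open>Interpolation takes place in \<open>1 / x\<close> rather than \<open>x\<close>, because
  pole orders bound exponents from below.\<close>

definition node_weight :: "'a::field set \<Rightarrow> 'a \<Rightarrow> 'a" where
  "node_weight C x = inverse (\<Prod>y\<in>C - {x}. 1 - y / x)"

text \<open>In terms of the inverse nodes, the weights are the values at \<open>0\<close> of the Lagrange basis.\<close>

lemma sum_node_weight_power_int:
  fixes C :: "'a::field set"
  assumes fin: "finite C" and nz: "0 \<notin> C" and e: "e \<le> 0" "- e < int (card C)"
  shows "(\<Sum>x\<in>C. node_weight C x * x powi e) = (if e = 0 then 1 else 0)"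
proof -
  define s where "s = nat (- e)"
  have s: "e = - int s" "s < card C"
    using e by (auto simp: s_def)
  have inj: "inj_on inverse C"
    by (auto intro: inj_onI)
  have "(\<Sum>x\<in>C. node_weight C x * x powi e) =
      (\<Sum>x\<in>C. inverse x ^ s * (\<Prod>y\<in>inverse ` C - {inverse x}. y / (y - inverse x)))"
  proof (intro sum.cong refl)
    fix x assume x: "x \<in> C"
    have "inverse ` C - {inverse x} = inverse ` (C - {x})"
      by auto
    then have "(\<Prod>y\<in>inverse ` C - {inverse x}. y / (y - inverse x)) =
        (\<Prod>y\<in>C - {x}. inverse y / (inverse y - inverse x))"
      by (simp add: prod.reindex[OF inj_on_subset[OF inj]])
    also have "\<dots> = (\<Prod>y\<in>C - {x}. inverse (1 - y / x))"
    proof (intro prod.cong refl)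
      fix y assume "y \<in> C - {x}"
      then have "y \<noteq> 0" "x \<noteq> 0" "y \<noteq> x"
        using x nz by auto
      then show "inverse y / (inverse y - inverse x) = inverse (1 - y / x)"
        by (simp add: field_simps)
    qed
    finally show "node_weight C x * x powi e =
        inverse x ^ s * (\<Prod>y\<in>inverse ` C - {inverse x}. y / (y - inverse x))"
      by (simp add: node_weight_def s power_int_minus power_inverse prod_inversef[symmetric])
  qed
  also have "\<dots> = (\<Sum>y\<in>inverse ` C. y ^ s * (\<Prod>x\<in>inverse ` C - {y}. x / (x - y)))"
    by (simp add: sum.reindex[OF inj])
  also have "\<dots> = 0 ^ s"
    using fin s by (intro lagrange_power_at_0) (simp_all add: card_image[OF inj])
  finally show ?thesis
    by (simp add: s)
qed

section \<open>Evaluation of Laurent polynomials\<close>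

definition eval_monomial :: "nat set \<Rightarrow> (nat \<Rightarrow> ratfun) \<Rightarrow> (nat \<Rightarrow>\<^sub>0 int) \<Rightarrow> ratfun" where
  "eval_monomial I c e = (\<Prod>i\<in>I. c i powi Poly_Mapping.lookup e i)"

definition laurent_eval :: "nat set \<Rightarrow> (nat \<Rightarrow> ratfun) \<Rightarrow> laurent \<Rightarrow> ratfun" where
  "laurent_eval I c f = (\<Sum>e\<in>Poly_Mapping.keys f. Poly_Mapping.lookup f e * eval_monomial I c e)"

lemma laurent_eval_superset:
  assumes "finite K" "Poly_Mapping.keys f \<subseteq> K"
  shows "laurent_eval I c f = (\<Sum>e\<in>K. Poly_Mapping.lookup f e * eval_monomial I c e)"
  unfolding laurent_eval_def using assms
  by (intro sum.mono_neutral_left) (auto simp: in_keys_iff)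

lemma laurent_eval_single:
  "laurent_eval I c (Poly_Mapping.single e a) = a * eval_monomial I c e"
  by (subst laurent_eval_superset[of "{e}"]) auto

lemma laurent_eval_zero [simp]: "laurent_eval I c 0 = 0"
  by (simp add: laurent_eval_def)

lemma laurent_eval_one [simp]: "laurent_eval I c 1 = 1"
  by (simp add: laurent_eval_single eval_monomial_def flip: single_one)

lemma laurent_eval_lconst [simp]: "laurent_eval I c (lconst a) = a"
  by (simp add: laurent_eval_single eval_monomial_def lconst_def)

lemma laurent_eval_add: "laurent_eval I c (f + g) = laurent_eval I c f + laurent_eval I c g"
proof -
  let ?K = "Poly_Mapping.keys f \<union> Poly_Mapping.keys g"
  have "Poly_Mapping.keys (f + g) \<subseteq> ?K"
    by (rule Poly_Mapping.keys_add)
  then show ?thesis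
    by (simp add: laurent_eval_superset[of ?K] lookup_add algebra_simps sum.distrib)
qed

lemma laurent_eval_diff: "laurent_eval I c (f - g) = laurent_eval I c f - laurent_eval I c g"
  using laurent_eval_add[of I c "f - g" g] by simp

lemma laurent_eval_sum: "laurent_eval I c (sum f A) = (\<Sum>a\<in>A. laurent_eval I c (f a))"
  by (induction A rule: infinite_finite_induct) (auto simp: laurent_eval_add)

lemma poly_mapping_sum_single:
  "f = (\<Sum>e\<in>Poly_Mapping.keys f. Poly_Mapping.single e (Poly_Mapping.lookup f e))"
proof (rule poly_mapping_eqI)
  fix e
  show "Poly_Mapping.lookup f e =
      Poly_Mapping.lookup (\<Sum>e\<in>Poly_Mapping.keys f. Poly_Mapping.single e (Poly_Mapping.lookup f e)) e"
    by (simp add: lookup_sum lookup_single when_def in_keys_iff)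
qed

context
  fixes I :: "nat set" and c :: "nat \<Rightarrow> ratfun"
  assumes nonzero: "0 \<notin> c ` I"
begin

text \<open>Nodes must be nonzero: with the convention for \<open>powi\<close> at 0, the exponents 1
  and -1 would give the product 0, but their sum gives 1.\<close>

lemma eval_monomial_add:
  "eval_monomial I c (a + b) = eval_monomial I c a * eval_monomial I c b"
  unfolding eval_monomial_def prod.distrib[symmetric]
proof (intro prod.cong refl)
  fix i assume "i \<in> I"
  then have "c i \<noteq> 0"
    using nonzero by auto
  then show "c i powi Poly_Mapping.lookup (a + b) i =
      c i powi Poly_Mapping.lookup a i * c i powi Poly_Mapping.lookup b i"
    by (simp add: lookup_add power_int_add)
qed

lemma laurent_eval_mult:
  "laurent_eval I c (f * g) = laurent_eval I c f * laurent_eval I c g"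
proof -
  have "laurent_eval I c (f * g) = laurent_eval I c
      ((\<Sum>a\<in>Poly_Mapping.keys f. Poly_Mapping.single a (Poly_Mapping.lookup f a)) *
       (\<Sum>b\<in>Poly_Mapping.keys g. Poly_Mapping.single b (Poly_Mapping.lookup g b)))"
    by (simp flip: poly_mapping_sum_single)
  also have "\<dots> = (\<Sum>a\<in>Poly_Mapping.keys f. \<Sum>b\<in>Poly_Mapping.keys g.
      Poly_Mapping.lookup f a * Poly_Mapping.lookup g b * eval_monomial I c (a + b))"
    by (simp add: sum_product mult_single laurent_eval_sum laurent_eval_single)
  also have "\<dots> = laurent_eval I c f * laurent_eval I c g"
    by (simp add: laurent_eval_def sum_product eval_monomial_add mult_ac)
  finally show ?thesis .
qed

lemma laurent_eval_power: "laurent_eval I c (f ^ m) = laurent_eval I c f ^ m"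
  by (induction m) (auto simp: laurent_eval_mult)

lemma laurent_eval_prod: "laurent_eval I c (prod f A) = (\<Prod>a\<in>A. laurent_eval I c (f a))"
  by (induction A rule: infinite_finite_induct) (auto simp: laurent_eval_mult)

lemma laurent_eval_q_poch:
  "laurent_eval I c (q_poch a (lconst q) k) = q_poch (laurent_eval I c a) q k"
  by (simp add: q_poch_def laurent_eval_prod laurent_eval_diff laurent_eval_mult laurent_eval_power)

end

lemma laurent_eval_lz:
  assumes "finite I" "i \<in> I"
  shows "laurent_eval I c (lz i) = c i"
proof -
  have "eval_monomial I c (Poly_Mapping.single i 1) = (\<Prod>j\<in>I. if i = j then c j else 1)"
    unfolding eval_monomial_def by (intro prod.cong refl) (auto simp: lookup_single)
  then show ?thesis
    using assms by (simp add: lz_def laurent_eval_single)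
qed

lemma laurent_eval_lz_inv:
  assumes "finite I" "i \<in> I"
  shows "laurent_eval I c (lz_inv i) = inverse (c i)"
proof -
  have "eval_monomial I c (Poly_Mapping.single i (- 1)) = (\<Prod>j\<in>I. if i = j then inverse (c j) else 1)"
    unfolding eval_monomial_def by (intro prod.cong refl) (auto simp: lookup_single power_int_minus)
  then show ?thesis
    using assms by (simp add: lz_inv_def laurent_eval_single)
qed

section \<open>Pole orders and the constant term as a grid sum\<close>

text \<open>Lower bounds suffice because the total degree is 0: every nonconstant monomial then has
  a negative exponent in some variable.\<close>

definition exponents_bounded :: "nat set \<Rightarrow> (nat \<Rightarrow> nat) \<Rightarrow> laurent \<Rightarrow> bool" where
  "exponents_bounded I d f \<longleftrightarrow> (\<forall>e\<in>Poly_Mapping.keys f.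
     (\<forall>i. - int (d i) \<le> Poly_Mapping.lookup e i) \<and> (\<forall>i. i \<notin> I \<longrightarrow> Poly_Mapping.lookup e i = 0) \<and>
     (\<Sum>i\<in>I. Poly_Mapping.lookup e i) = 0)"

lemma exponents_bounded_mult:
  assumes "exponents_bounded I d f" "exponents_bounded I d' g"
  shows "exponents_bounded I (\<lambda>i. d i + d' i) (f * g)"
  unfolding exponents_bounded_def
proof
  fix e assume "e \<in> Poly_Mapping.keys (f * g)"
  then obtain a b where "e = a + b" "a \<in> Poly_Mapping.keys f" "b \<in> Poly_Mapping.keys g"
    using Poly_Mapping.keys_mult[of f g] by blast
  moreover from this(2,3) have "- int (d i) - int (d' i) \<le> Poly_Mapping.lookup a i + Poly_Mapping.lookup b i" for i
    using assms unfolding exponents_bounded_def by (smt (verit))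
  ultimately show "(\<forall>i. - int (d i + d' i) \<le> Poly_Mapping.lookup e i) \<and>
      (\<forall>i. i \<notin> I \<longrightarrow> Poly_Mapping.lookup e i = 0) \<and> (\<Sum>i\<in>I. Poly_Mapping.lookup e i) = 0"
    using assms unfolding exponents_bounded_def by (simp add: lookup_add sum.distrib)
qed

lemma exponents_bounded_one: "exponents_bounded I (\<lambda>_. 0) 1"
  by (simp add: exponents_bounded_def)

lemma exponents_bounded_prod:
  assumes "\<And>a. a \<in> A \<Longrightarrow> exponents_bounded I (d a) (f a)"
  shows "exponents_bounded I (\<lambda>i. \<Sum>a\<in>A. d a i) (prod f A)"
  using assms by (induction A rule: infinite_finite_induct)
    (auto simp: exponents_bounded_one intro: exponents_bounded_mult)

text \<open>For a single monomial the weighted grid sum factors over the variables. A variable with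
  negative exponent, at least \<open>- d i\<close>, contributes 0, so the factors with positive
  exponents need not be known; only the constant monomial survives, with factor 1.\<close>

lemma CT_eq_sum_over_grid:
  assumes fin: "finite I" and C: "\<And>i. i \<in> I \<Longrightarrow> finite (C i) \<and> 0 \<notin> C i \<and> card (C i) = Suc (d i)"
    and f: "exponents_bounded I d f"
  shows "CT f = (\<Sum>c\<in>PiE I C. (\<Prod>i\<in>I. node_weight (C i) (c i)) * laurent_eval I c f)"
proof -
  let ?K = "Poly_Mapping.keys f"
  have one: "(\<Prod>i\<in>I. \<Sum>x\<in>C i. node_weight (C i) x * x powi Poly_Mapping.lookup e i) =
      (if e = 0 then 1 else 0)" if e: "e \<in> ?K" for e
  proof (cases "e = 0")
    case True
    then show ?thesis
      using C sum_node_weight_power_int[of "C i" 0 for i] by (auto intro!: prod.neutral)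
  next
    case False
    have bd: "- int (d i) \<le> Poly_Mapping.lookup e i" for i
      using f e by (auto simp: exponents_bounded_def)
    have out: "Poly_Mapping.lookup e i = 0" if "i \<notin> I" for i
      using f e that by (auto simp: exponents_bounded_def)
    have sum0: "(\<Sum>i\<in>I. Poly_Mapping.lookup e i) = 0"
      using f e by (auto simp: exponents_bounded_def)
    have "\<exists>i\<in>I. Poly_Mapping.lookup e i < 0"
    proof (rule ccontr)
      assume "\<not> ?thesis"
      then have "\<forall>i\<in>I. Poly_Mapping.lookup e i = 0"
        using sum_nonneg_eq_0_iff[OF fin, of "Poly_Mapping.lookup e"] sum0 by (simp add: not_less)
      then have "e = 0"
        using out by (intro poly_mapping_eqI) (metis lookup_zero)
      with False show False ..
    qed
    then obtain i where i: "i \<in> I" "Poly_Mapping.lookup e i < 0" ..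
    have "(\<Sum>x\<in>C i. node_weight (C i) x * x powi Poly_Mapping.lookup e i) = 0"
      using sum_node_weight_power_int[of "C i" "Poly_Mapping.lookup e i"] C[OF i(1)] i(2) bd[of i] by auto
    then show ?thesis
      using False fin i(1) by (auto intro: prod_zero)
  qed
  have "(\<Sum>c\<in>PiE I C. (\<Prod>i\<in>I. node_weight (C i) (c i)) * laurent_eval I c f) =
      (\<Sum>c\<in>PiE I C. \<Sum>e\<in>?K. Poly_Mapping.lookup f e *
        (\<Prod>i\<in>I. node_weight (C i) (c i) * c i powi Poly_Mapping.lookup e i))"
    by (simp add: laurent_eval_def eval_monomial_def sum_distrib_left prod.distrib mult_ac)
  also have "\<dots> = (\<Sum>e\<in>?K. Poly_Mapping.lookup f e * (\<Sum>c\<in>PiE I C.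
        \<Prod>i\<in>I. node_weight (C i) (c i) * c i powi Poly_Mapping.lookup e i))"
    by (subst sum.swap) (simp add: sum_distrib_left)
  also have "\<dots> = (\<Sum>e\<in>?K. Poly_Mapping.lookup f e * (if e = 0 then 1 else 0))"
  proof (intro sum.cong refl arg_cong2[of _ _ _ _ "(*)"])
    fix e assume "e \<in> ?K"
    then show "(\<Sum>c\<in>PiE I C. \<Prod>i\<in>I. node_weight (C i) (c i) * c i powi Poly_Mapping.lookup e i) =
        (if e = 0 then 1 else 0)"
      using prod_sum_PiE[OF fin, of C "\<lambda>i x. node_weight (C i) x * x powi Poly_Mapping.lookup e i"]
        one C by simp
  qed
  also have "\<dots> = Poly_Mapping.lookup f 0"
    by (simp add: in_keys_iff if_distrib[of "(*) _"] cong: if_cong)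
  finally show ?thesis
    by (simp add: CT_def)
qed

section \<open>Grid points with separated exponents\<close>

text \<open>The truncated subtraction makes the last summand vanish for \<open>i \<le> n\<^sub>0\<close>.\<close>

definition extremal_point :: "nat \<Rightarrow> nat \<Rightarrow> nat \<Rightarrow> nat" where
  "extremal_point n0 k i = (i - 1) * k + (i - 1 - n0)"

lemma separated_exponents_unique:
  fixes \<alpha> :: "nat \<Rightarrow> nat"
  assumes "n1 \<ge> 1" "k \<ge> 1" and n: "n = n0 + n1"
    and le: "\<And>i. i \<in> {1..n} \<Longrightarrow> \<alpha> i \<le> (n - 1) * k + (n1 - 1)"
    and avoid: "\<And>i j. i \<in> {1..n0} \<Longrightarrow> j \<in> {1..<n1} \<Longrightarrow> \<alpha> i \<noteq> (n0 - 1 + j) * k + j"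
    and sep: "\<And>i j. 1 \<le> i \<Longrightarrow> i < j \<Longrightarrow> j \<le> n \<Longrightarrow>
      \<alpha> i + (if n0 < i then k + 1 else k) \<le> \<alpha> j \<or> \<alpha> j + (if n0 < i then k + 1 else k) < \<alpha> i"
    and i: "i \<in> {1..n}"
  shows "\<alpha> i = extremal_point n0 k i"
proof -
  \<comment> \<open>Listing the indices by increasing exponent turns the pairwise separation into
    lower bounds for consecutive gaps. The aim is to show that this list is in natural
    order.\<close>
  define xs where "xs = sort_key \<alpha> [1..<n+1]"
  define g where "g p = \<alpha> (xs ! p)" for p
  define w where "w p = (if n0 < xs ! p then 1 else 0 :: nat)" for p
  define cnt where "cnt p = (\<Sum>r<p. w r)" for p
  have len: "length xs = n" and set_xs: "set xs = {1..n}" and dist: "distinct xs"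
    by (auto simp: xs_def)
  have mem: "xs ! p \<in> {1..n}" if "p < n" for p
    using that len set_xs nth_mem by metis
  have mono: "g p \<le> g (Suc p)" if "Suc p < n" for p
    using sorted_sort_key[of \<alpha> "[1..<n+1]"] that len
    unfolding xs_def[symmetric] sorted_iff_nth_Suc g_def by simp
  have neq: "xs ! p \<noteq> xs ! Suc p" if "Suc p < n" for p
    using that dist len by (simp add: nth_eq_iff_index_eq)
  have cnt_Suc: "cnt (Suc p) = cnt p + w p" for p
    by (simp add: cnt_def)
  \<comment> \<open>If the two indices are in descending order, \<open>sep\<close> applies with
    their roles exchanged and only guarantees the multiplicity of the later position. Its strict
    inequality makes up for the possible loss of 1.\<close>
  have step: "g p + k + w p \<le> g (Suc p)" if "Suc p < n" for p
    using sep[of "xs ! p" "xs ! Suc p"] sep[of "xs ! Suc p" "xs ! p"] mem[of p] mem[of "Suc p"]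
      mono[OF that] neq[OF that] that \<open>k \<ge> 1\<close>
    by (cases "xs ! p < xs ! Suc p") (auto simp: g_def w_def split: if_splits)
  \<comment> \<open>When that loss does not occur, the strict inequality is a genuine gain.\<close>
  have descent: "g p + k + w p < g (Suc p)"
    if "Suc p < n" "xs ! Suc p < xs ! p" "n0 < xs ! p \<Longrightarrow> n0 < xs ! Suc p" for p
    using sep[of "xs ! Suc p" "xs ! p"] mem[of p] mem[of "Suc p"] mono[OF that(1)] that \<open>k \<ge> 1\<close>
    by (auto simp: g_def w_def split: if_splits)
  have steps: "g a + b * k + cnt b \<le> g b + a * k + cnt a" if "a \<le> b" "b < n" for a b
    using that
  proof (induction b rule: dec_induct)
    case (step b)
    then show ?case
      using \<open>Suc b < n \<Longrightarrow> g b + k + w b \<le> g (Suc b)\<close> by (simp add: cnt_Suc)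
  qed simp
  have "cnt n = (\<Sum>p<n. (\<lambda>i. if n0 < i then 1 else 0) (xs ! p))"
    by (simp add: cnt_def w_def)
  also have "\<dots> = (\<Sum>i\<in>{1..n}. if n0 < i then 1 else 0)"
    using bij_betw_nth[OF dist, of "{..<n}" "{1..n}"] len set_xs
    by (intro sum.reindex_bij_betw) simp
  also have "\<dots> = card {i\<in>{1..n}. n0 < i}"
    by (simp add: sum.If_cases Int_def)
  also have "{i\<in>{1..n}. n0 < i} = {n0+1..n}"
    by auto
  finally have cnt_n: "cnt n = n1"
    by (simp add: n)
  define l where "l = n - 1"
  have l: "n = Suc l" "l < n"
    using n \<open>n1 \<ge> 1\<close> by (auto simp: l_def)
  have gl: "g l \<le> l * k + (n1 - 1)"
    using le[of "xs ! l"] mem[of l] l by (simp add: g_def)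
  have cnt_l: "cnt l + w l = n1"
    using cnt_n cnt_Suc[of l] l by simp
  have wl: "w l = 1"
  proof (rule ccontr)
    assume "w l \<noteq> 1"
    then have "cnt l = n1"
      using cnt_l by (auto simp: w_def split: if_splits)
    then show False
      using steps[of 0 l] gl l \<open>n1 \<ge> 1\<close> by (simp add: cnt_def)
  qed
  have cntl: "cnt l = n1 - 1"
    using cnt_l wl by simp
  \<comment> \<open>Adding the gaps from 0 to \<open>p\<close> bounds \<open>g p\<close> from below;
    adding those from \<open>p\<close> to \<open>l\<close> and using \<open>gl\<close> bounds it
    from above by the same number.\<close>
  have tight: "g p = p * k + cnt p" if "p < n" for p
    using steps[of 0 p] steps[of p l] that l gl cntl by (simp add: cnt_def)
  have cnt_mono: "cnt a \<le> cnt b" if "a \<le> b" for a b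
    unfolding cnt_def using that by (intro sum_mono2) auto
  have NJ: "n0 < xs ! b" if "a \<le> b" "b < n" "n0 < xs ! a" for a b
  proof (rule ccontr)
    assume "\<not> n0 < xs ! b"
    \<comment> \<open>Let \<open>p\<close> be the last position of an index at most
      \<open>n0\<close>. Only larger indices follow, so \<open>p = n0 - 1 + cnt p\<close>. Position
      \<open>a\<close> gives \<open>cnt p \<ge> 1\<close>, and \<open>p \<noteq> l\<close> gives
      \<open>cnt p < n1\<close>. Thus \<open>g p\<close> is one of the values excluded by
      \<open>avoid\<close>.\<close>
    define Q where "Q = {p. p < n \<and> xs ! p \<le> n0}"
    have Q: "finite Q" "b \<in> Q"
      using that \<open>\<not> n0 < xs ! b\<close> by (auto simp: Q_def)
    define p where "p = Max Q"
    have p: "p \<in> Q" "b \<le> p" and p_max: "\<And>r. r \<in> Q \<Longrightarrow> r \<le> p"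
      unfolding p_def using Q by (auto intro!: Max_in)
    have pn: "p < n" "xs ! p \<le> n0" "p \<noteq> l"
      using p wl by (auto simp: Q_def w_def)
    have "a < p"
      using that p pn by (metis le_neq_implies_less le_trans not_le)
    have "(\<Sum>r\<in>{p..<n}. w r) = (\<Sum>r\<in>{Suc p..<n}. w r) + w p"
      using pn by (simp add: sum.atLeast_Suc_lessThan)
    also have "(\<Sum>r\<in>{Suc p..<n}. w r) = (\<Sum>r\<in>{Suc p..<n}. 1)"
      using p_max by (intro sum.cong refl) (fastforce simp: w_def Q_def)
    finally have "(\<Sum>r\<in>{p..<n}. w r) = n - Suc p"
      using pn by (simp add: w_def)
    moreover have "cnt n = cnt p + (\<Sum>r\<in>{p..<n}. w r)"
      using pn unfolding cnt_def by (metis atLeast0LessThan less_imp_le sum.atLeastLessThan_concat zero_le)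
    ultimately have cp: "cnt p + (n - Suc p) = n1"
      using cnt_n by simp
    have "1 \<le> w a"
      using that by (simp add: w_def)
    also have "w a \<le> cnt (Suc a)"
      by (simp add: cnt_Suc)
    also have "\<dots> \<le> cnt p"
      using \<open>a < p\<close> by (intro cnt_mono) simp
    finally have "cnt p \<in> {1..<n1}"
      using cp pn l by auto
    moreover have "xs ! p \<in> {1..n0}"
      using mem[of p] pn by simp
    moreover have "p = n0 - 1 + cnt p"
      using cp n pn \<open>xs ! p \<in> {1..n0}\<close> by simp
    ultimately show False
      using avoid[of "xs ! p" "cnt p"] tight[of p] pn by (simp add: g_def)
  qed
  \<comment> \<open>By \<open>NJ\<close> a descent would satisfy the last premise of
    \<open>descent\<close> and so need a larger gap than the tight one.\<close>
  have ascend: "xs ! p < xs ! Suc p" if "Suc p < n" for p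
    using descent[OF that] NJ[of p "Suc p"] tight[of p] tight[of "Suc p"] cnt_Suc[of p] that neq[OF that]
    by (auto simp: nat_neq_iff)
  have "sorted xs"
    unfolding sorted_iff_nth_Suc len using ascend less_imp_le by blast
  then have xs: "xs = [1..<n+1]"
    using sorted_distinct_set_unique[of xs "[1..<n+1]"] dist set_xs
    by (simp add: atLeastLessThanSuc_atLeastAtMost del: upt_Suc)
  have "cnt p = p - n0" if "p \<le> n" for p
  proof -
    have "cnt p = (\<Sum>r<p. if n0 \<le> r then 1 else 0)"
      unfolding cnt_def w_def xs using that
      by (intro sum.cong) (auto simp del: upt_Suc)
    also have "\<dots> = card {r\<in>{..<p}. n0 \<le> r}"
      by (simp add: sum.If_cases Int_def)
    also have "{r\<in>{..<p}. n0 \<le> r} = {n0..<p}"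
      by auto
    finally show ?thesis by simp
  qed
  moreover have "i - 1 < n"
    using i by auto
  ultimately show ?thesis
    using tight[of "i - 1"] i by (simp add: g_def xs extremal_point_def del: upt_Suc)
qed

section \<open>Telescoping to the product formula\<close>

definition profile :: "nat \<Rightarrow> nat \<Rightarrow> nat \<Rightarrow> nat" where
  "profile k u v = (u + v) * k + v"

lemma profile_Suc: "profile k (Suc u) v = profile k u v + k" "profile k u (Suc v) = Suc (profile k (Suc u) v)"
  by (simp_all add: profile_def algebra_simps)

lemma q_poch_Suc: "q_poch x q (Suc m) = q_poch x q m * (1 - x * q ^ m)"
  by (simp add: q_poch_def)

lemma q_poch_0 [simp]: "q_poch x q 0 = 1"
  by (simp add: q_poch_def)

lemma q_poch_shift:
  "q_poch q q m * (\<Prod>l<r. 1 - q ^ (m + l + 1)) = q_poch q q (m + r)"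
  by (induction r) (simp_all add: q_poch_Suc mult.assoc[symmetric])

text \<open>
  The contributions of \<open>z\<^bsub>n\<^sub>0-u\<^esub>\<close> and of \<open>z\<^bsub>n-s\<^esub>\<close>, \<open>s < n\<^sub>1\<close>, at the surviving grid point;
  \<open>profile k u v\<close> is the difference of the exponents of \<open>z\<^bsub>n\<^sub>0+1+v\<^esub>\<close> and \<open>z\<^bsub>n\<^sub>0+1-u\<^esub>\<close> there.
\<close>

definition early_factor :: "'a::field \<Rightarrow> nat \<Rightarrow> nat \<Rightarrow> nat \<Rightarrow> 'a" where
  "early_factor q n1 k u = q_poch q q (Suc u * k) / q_poch q q k * (\<Prod>v<n1. q_poch q q (profile k (Suc u) v + k) / q_poch q q (profile k (Suc u) v))
    * (\<Prod>v<n1 - 1. 1 - q ^ Suc (profile k (Suc u) v)) / q_poch q q (profile k (Suc u) (n1 - 1))"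

definition late_factor :: "'a::field \<Rightarrow> nat \<Rightarrow> nat \<Rightarrow> 'a" where
  "late_factor q k s = q_poch q q (Suc s * (k + 1)) / (q_poch q q (k + 1) * q_poch q q (s * (k + 1)))"

context
  fixes q :: "'a::field"
  assumes power_neq_1: "\<And>m. m > 0 \<Longrightarrow> q ^ m \<noteq> 1"
begin

abbreviation P :: "nat \<Rightarrow> 'a" where "P m \<equiv> q_poch q q m"

lemma P_nonzero [simp]: "P m \<noteq> 0"
  using power_neq_1[of "Suc l" for l] by (auto simp: q_poch_def)

lemma q_factorial_eq: "q_factorial q m = P m / (1 - q) ^ m"
  by (induction m) (simp_all add: q_factorial_def q_poch_Suc q_bracket_def)

text \<open>This form telescopes over \<open>u\<close>. By \<open>profile_Suc\<close>, each factor
  \<open>1 - q ^ Suc (profile k (Suc u) v)\<close> is the quotient of \<open>P\<close> at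
  \<open>profile k u (Suc v)\<close> and at \<open>profile k (Suc u) v\<close>, which turns the
  second half of \<open>early_factor\<close> into a quotient of neighbouring
  \<open>Y\<close>.\<close>

lemma early_factor_eq:
  defines "X n1 k u \<equiv> (\<Prod>v<n1. P (profile k (Suc u) v))"
    and "Y n1 k u \<equiv> (\<Prod>v<n1 - 1. P (profile k u (Suc v)))"
  shows "early_factor q n1 k u = inverse (P k) * (X n1 k (Suc u) / X n1 k u) / (Y n1 k (Suc u) / Y n1 k u)"
proof -
  have "P (Suc u * k) * (\<Prod>v<m. 1 - q ^ Suc (profile k (Suc u) v)) / P (profile k (Suc u) m) =
      (\<Prod>v<m. P (profile k u (Suc v))) / (\<Prod>v<m. P (profile k (Suc u) (Suc v)))" for m
  proof (induction m)
    case 0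
    then show ?case by (simp add: profile_def)
  next
    case (Suc m)
    have *: "P (profile k u (Suc m)) = P (profile k (Suc u) m) * (1 - q ^ Suc (profile k (Suc u) m))"
      by (simp add: profile_Suc(2) q_poch_Suc)
    have "P (Suc u * k) * (\<Prod>v<Suc m. 1 - q ^ Suc (profile k (Suc u) v)) / P (profile k (Suc u) (Suc m)) =
      P (Suc u * k) * (\<Prod>v<m. 1 - q ^ Suc (profile k (Suc u) v)) / P (profile k (Suc u) m) *
      P (profile k u (Suc m)) / P (profile k (Suc u) (Suc m))"
      unfolding * by (simp del: power_Suc mult_Suc)
    then show ?case
      unfolding Suc by simp
  qed
  note * = this[of "n1 - 1"]
  have "early_factor q n1 k u = inverse (P k) * (\<Prod>v<n1. P (profile k (Suc (Suc u)) v) / P (profile k (Suc u) v)) *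
    (P (Suc u * k) * (\<Prod>v<n1 - 1. 1 - q ^ Suc (profile k (Suc u) v)) / P (profile k (Suc u) (n1 - 1)))"
    unfolding early_factor_def profile_Suc(1)[symmetric] divide_inverse by (simp only: mult_ac)
  then show ?thesis
    unfolding * X_def Y_def prod_dividef by simp
qed

lemma prod_early_factor:
  "(\<Prod>u<n0. early_factor q n1 k u) =
     (\<Prod>v<n1. P (profile k (Suc n0) v)) / (\<Prod>v<n1. P (profile k 1 v)) *
     (\<Prod>v<n1 - 1. P (profile k 0 (Suc v))) / (\<Prod>v<n1 - 1. P (profile k n0 (Suc v))) / P k ^ n0"
proof -
  have X: "(\<Prod>u<n0. (\<Prod>v<n1. P (profile k (Suc (Suc u)) v)) / (\<Prod>v<n1. P (profile k (Suc u) v))) =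
      (\<Prod>v<n1. P (profile k (Suc n0) v)) / (\<Prod>v<n1. P (profile k 1 v))"
    by (subst prod_lessThan_telescope) simp_all
  have Y: "(\<Prod>u<n0. (\<Prod>v<n1 - 1. P (profile k (Suc u) (Suc v))) / (\<Prod>v<n1 - 1. P (profile k u (Suc v)))) =
      (\<Prod>v<n1 - 1. P (profile k n0 (Suc v))) / (\<Prod>v<n1 - 1. P (profile k 0 (Suc v)))"
    by (subst prod_lessThan_telescope) simp_all
  have "(\<Prod>u<n0. early_factor q n1 k u) = (\<Prod>u<n0. inverse (P k)) *
    (\<Prod>u<n0. (\<Prod>v<n1. P (profile k (Suc (Suc u)) v)) / (\<Prod>v<n1. P (profile k (Suc u) v))) /
    (\<Prod>u<n0. (\<Prod>v<n1 - 1. P (profile k (Suc u) (Suc v))) / (\<Prod>v<n1 - 1. P (profile k u (Suc v))))"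
    unfolding early_factor_eq by (simp only: prod.distrib prod_dividef)
  then show ?thesis
    unfolding X Y by (simp add: power_inverse divide_inverse)
qed

text \<open>Telescoping the early factors leaves boundary terms with first profile argument 0, 1,
  \<open>n0\<close> and \<open>Suc n0\<close>. Those with 0 and 1 cancel against the late factors;
  the other two give the quotients over \<open>j\<close>. The remaining \<open>P (n0 * k)\<close> is
  the telescoped product over \<open>l\<close>, and all powers of \<open>1 - q\<close>
  cancel.\<close>

lemma prod_factors_eq:
  assumes "n1 \<ge> 1"
  shows "(\<Prod>s<n1. late_factor q k s) * (\<Prod>u<n0. early_factor q n1 k u) =
    q_Gamma (q ^ (k + 1)) (n1 + 1) / q_Gamma q (1 + k) ^ (n0 + n1)
    * (\<Prod>j = 0..<n1. q_Gamma q ((k + 1) * (j + 1) + k * n0) / q_Gamma q ((k + 1) * j + k * n0 + 1))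
    * (\<Prod>l = 0..<n0. q_Gamma q (1 + k * (l + 1)) / q_Gamma q (1 + k * l))"
proof -
  obtain m where m: "n1 = Suc m"
    using assms by (cases n1) auto
  have q1: "1 - q \<noteq> 0"
    using power_neq_1[of 1] by simp
  have qk: "1 - q ^ Suc k \<noteq> 0"
    using power_neq_1[of "Suc k"] by simp
  have Y: "(\<Prod>v<n1 - 1. P (profile k u (Suc v))) = (\<Prod>v<n1. P (profile k u v)) / P (u * k)" for u
    unfolding m by (subst prod.lessThan_Suc_shift) (simp add: profile_def)
  have late: "late_factor q k s = (1 - q ^ ((k + 1) * (s + 1))) / (1 - q ^ (k + 1)) * P (profile k 1 s) / P (profile k 0 s) / P k" for s
  proof -
    have "Suc s * (k + 1) = Suc (profile k 1 s)"
      by (simp add: profile_def algebra_simps)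
    then have "P (Suc s * (k + 1)) = P (profile k 1 s) * (1 - q ^ (Suc s * (k + 1)))"
      by (simp only: q_poch_Suc flip: power_Suc)
    then show ?thesis
      using qk by (simp add: late_factor_def q_poch_Suc profile_def ac_simps divide_simps)
  qed
  have base: "q_Gamma (q ^ (k + 1)) (n1 + 1) = (\<Prod>s<n1. (1 - q ^ ((k + 1) * (s + 1))) / (1 - q ^ (k + 1)))"
    by (simp add: q_Gamma_def q_factorial_def q_bracket_def prod.atLeast1_atMost_eq power_mult
        del: power_Suc mult_Suc mult_Suc_right)
  have J: "q_Gamma q ((k + 1) * (j + 1) + k * n0) / q_Gamma q ((k + 1) * j + k * n0 + 1) =
      P (profile k (Suc n0) j) / P (profile k n0 j) / (1 - q) ^ k" for j
  proof -
    \<comment> \<open>The subtraction of 1 is the shift in \<open>q_Gamma\<close>; it is not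
      truncated, since \<open>(k + 1) * (j + 1)\<close> is positive.\<close>
    have *: "(k + 1) * (j + 1) + k * n0 - 1 = profile k n0 j + k" "(k + 1) * j + k * n0 = profile k n0 j"
      by (simp_all add: profile_def algebra_simps)
    show ?thesis
      using q1 unfolding q_Gamma_def add_diff_cancel_right' * q_factorial_eq profile_Suc(1)
      by (simp add: power_add)
  qed
  have N: "q_Gamma q (1 + k * (l + 1)) / q_Gamma q (1 + k * l) = P (k * Suc l) / P (k * l) / (1 - q) ^ k" for l
    using q1 by (simp add: q_Gamma_def q_factorial_eq power_add)
  have K: "q_Gamma q (1 + k) = P k / (1 - q) ^ k"
    by (simp add: q_Gamma_def q_factorial_eq)
  have tele: "(\<Prod>l<n0. P (k * Suc l) / P (k * l)) = P (n0 * k)"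
    by (subst prod_lessThan_telescope) (simp_all add: mult.commute)
  have "(\<Prod>s<n1. late_factor q k s) * (\<Prod>u<n0. early_factor q n1 k u) =
    (\<Prod>s<n1. (1 - q ^ ((k + 1) * (s + 1))) / (1 - q ^ (k + 1))) / P k ^ (n0 + n1)
     * ((\<Prod>v<n1. P (profile k (Suc n0) v)) / (\<Prod>v<n1. P (profile k n0 v))) * P (n0 * k)"
    unfolding prod_early_factor Y late prod.distrib prod_dividef
    by (simp add: power_add field_simps del: power_Suc)
  then show ?thesis
    unfolding base J N K atLeast0LessThan prod.distrib prod_dividef[of _ "\<lambda>_. (1 - q) ^ k"] tele
    using q1 by (simp add: prod_dividef power_add power_divide mult_ac del: power_Suc)
qed

end

section \<open>The constant term as a product over pairs\<close>

lemma q_indet_power_eq_iff: "q_indet ^ a = q_indet ^ b \<longleftrightarrow> a = b"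
proof
  have pow: "q_indet ^ m = Fract (monom 1 m) 1" for m
    by (induction m) (simp_all add: q_indet_def One_fract_def monom_Suc)
  assume "q_indet ^ a = q_indet ^ b"
  then have "degree (monom (1 :: rat) a) = degree (monom (1 :: rat) b)"
    by (simp add: pow eq_fract)
  then show "a = b"
    by (simp add: degree_monom_eq)
qed simp

lemma q_indet_nonzero [simp]: "q_indet \<noteq> 0"
  using q_indet_power_eq_iff[of 1 2] by auto

lemma q_indet_power_neq_1: "m > 0 \<Longrightarrow> q_indet ^ m \<noteq> 1"
  using q_indet_power_eq_iff[of m 0] by simp

definition pair_multiplicity :: "nat \<Rightarrow> nat \<Rightarrow> nat \<Rightarrow> nat" where
  "pair_multiplicity n0 k i = (if n0 < i then k + 1 else k)"

definition pair_factor :: "nat \<Rightarrow> nat \<Rightarrow> nat \<Rightarrow> laurent" where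
  "pair_factor l i j = q_poch (lz i * lz_inv j) (lconst q_indet) l *
     q_poch (lconst q_indet * (lz j * lz_inv i)) (lconst q_indet) l"

text \<open>The new factors of the two q-Pochhammer symbols multiply to the factor in the first
  product of \<open>D1_00\<close>. That product therefore just raises the multiplicity from
  \<open>k\<close> to \<open>k + 1\<close> for pairs with \<open>i > n0\<close>.\<close>

lemma pair_factor_Suc:
  "pair_factor (Suc k) i j = pair_factor k i j *
     ((lz i - lconst q_indet ^ (k + 1) * lz j) * (lz_inv i - lconst q_indet ^ k * lz_inv j))"
proof -
  have expand: "(1 - x * y' * Q) * (1 - R * (y * x') * Q) = (x - R * Q * y) * (x' - Q * y')"
    if "x * x' = 1" "y * y' = 1" for x x' y y' Q R :: laurent
    using that by algebra
  have "pair_factor (Suc k) i j = pair_factor k i j *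
      ((1 - lz i * lz_inv j * lconst q_indet ^ k) *
       (1 - lconst q_indet * (lz j * lz_inv i) * lconst q_indet ^ k))"
    by (simp only: pair_factor_def q_poch_Suc mult_ac)
  also have "\<dots> = pair_factor k i j *
      ((lz i - lconst q_indet ^ (k + 1) * lz j) * (lz_inv i - lconst q_indet ^ k * lz_inv j))"
    unfolding expand[OF lz_mult_lz_inv lz_mult_lz_inv] by (simp add: mult_ac)
  finally show ?thesis .
qed

lemma prod_pairs_eq:
  fixes f :: "nat \<Rightarrow> nat \<Rightarrow> 'a::comm_monoid_mult"
  shows "(\<Prod>(i, j) \<in> {(i, j). 1 \<le> i \<and> i < j \<and> j \<le> n}. f i j) = (\<Prod>j\<in>{1..n}. \<Prod>i\<in>{1..<j}. f i j)"
    and "(\<Prod>(i, j) \<in> {(i, j). 1 \<le> i \<and> i < j \<and> j \<le> n}. f i j) = (\<Prod>i\<in>{1..n}. \<Prod>j\<in>{i<..n}. f i j)"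
proof -
  have "{(i, j). 1 \<le> i \<and> i < j \<and> j \<le> n} = prod.swap ` (SIGMA j:{1..n}. {1..<j})"
    by (auto simp: image_iff)
  then show "(\<Prod>(i, j) \<in> {(i, j). 1 \<le> i \<and> i < j \<and> j \<le> n}. f i j) = (\<Prod>j\<in>{1..n}. \<Prod>i\<in>{1..<j}. f i j)"
    by (simp add: prod.reindex prod.Sigma case_prod_unfold)
  have "{(i, j). 1 \<le> i \<and> i < j \<and> j \<le> n} = (SIGMA i:{1..n}. {i<..n})"
    by auto
  then show "(\<Prod>(i, j) \<in> {(i, j). 1 \<le> i \<and> i < j \<and> j \<le> n}. f i j) = (\<Prod>i\<in>{1..n}. \<Prod>j\<in>{i<..n}. f i j)"
    by (simp add: prod.Sigma)
qed

lemma finite_pairs: "finite {(i :: nat, j :: nat). 1 \<le> i \<and> i < j \<and> j \<le> n}"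
  by (rule finite_subset[of _ "{..n} \<times> {..n}"]) auto

lemma D1_00_eq_CT:
  "D1_00 n1 n0 k =
     CT (\<Prod>j\<in>{1..n0+n1}. \<Prod>i\<in>{1..<j}. pair_factor (pair_multiplicity n0 k i) i j)"
proof -
  let ?S = "{(i, j). 1 \<le> i \<and> i < j \<and> j \<le> n0 + n1}"
  let ?g = "\<lambda>i j. (lz i - lconst q_indet ^ (k + 1) * lz j) * (lz_inv i - lconst q_indet ^ k * lz_inv j)"
  have "(\<Prod>(i, j) \<in> {(i, j). n0 + 1 \<le> i \<and> i < j \<and> j \<le> n0 + n1}. ?g i j) =
      (\<Prod>(i, j) \<in> ?S. if n0 < i then ?g i j else 1)"
    using finite_pairs[of "n0 + n1"] by (intro prod.mono_neutral_cong_left) (auto split: if_splits)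
  moreover have "(\<Prod>(i, j) \<in> ?S. pair_factor (pair_multiplicity n0 k i) i j) =
      (\<Prod>(i, j) \<in> ?S. if n0 < i then ?g i j else 1) * (\<Prod>(i, j) \<in> ?S. pair_factor k i j)"
    unfolding prod.distrib[symmetric]
    by (intro prod.cong refl) (auto simp: pair_multiplicity_def pair_factor_Suc mult.commute)
  ultimately show ?thesis
    unfolding D1_00_def Let_def prod_pairs_eq(1)[symmetric] pair_factor_def by simp
qed

section \<open>Pole orders of the pair factors and the size of the grid\<close>

lemma exponents_bounded_mono:
  "exponents_bounded I d f \<Longrightarrow> (\<And>i. d i \<le> d' i) \<Longrightarrow> exponents_bounded I d' f"
  unfolding exponents_bounded_def by (smt (verit) of_nat_le_iff)

text \<open>Each of the \<open>l\<close> factors can lower only the exponent of \<open>lz j\<close>,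
  by one. The constant \<open>a\<close> covers both symbols in \<open>pair_factor\<close>.\<close>

lemma exponents_bounded_q_poch:
  assumes "finite I" "i \<in> I" "j \<in> I" "i \<noteq> j"
  shows "exponents_bounded I (\<lambda>x. if x = j then l else 0) (q_poch (lconst a * (lz i * lz_inv j)) (lconst q) l)"
proof -
  have "exponents_bounded I (\<lambda>x. if x = j then 1 else 0) (1 - lconst a * (lz i * lz_inv j) * lconst q ^ m)" for m
  proof -
    let ?e = "Poly_Mapping.single i 1 + Poly_Mapping.single j (- 1) :: nat \<Rightarrow>\<^sub>0 int"
    have "lconst q ^ m = lconst (q ^ m)"
      by (induction m) (simp_all add: lconst_def mult_single)
    then have "1 - lconst a * (lz i * lz_inv j) * lconst q ^ m =
        Poly_Mapping.single 0 1 - Poly_Mapping.single ?e (a * q ^ m)"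
      by (simp add: lconst_def lz_def lz_inv_def mult_single)
    then have keys: "Poly_Mapping.keys (1 - lconst a * (lz i * lz_inv j) * lconst q ^ m) \<subseteq> {0, ?e}"
      by (auto simp: in_keys_iff lookup_minus lookup_single lookup_one when_def split: if_splits)
    have "(\<Sum>x\<in>I. Poly_Mapping.lookup ?e x) = 0"
      using assms by (simp add: lookup_add lookup_single when_def sum.distrib)
    then show ?thesis
      unfolding exponents_bounded_def using keys assms
      by (auto simp: lookup_add lookup_single when_def)
  qed
  then have "exponents_bounded I (\<lambda>x. \<Sum>m<l. if x = j then 1 else 0)
      (q_poch (lconst a * (lz i * lz_inv j)) (lconst q) l)"
    unfolding q_poch_def by (intro exponents_bounded_prod)
  then show ?thesis
    by (rule exponents_bounded_mono) auto
qed

lemma exponents_bounded_pair_factor: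
  assumes "finite I" "i \<in> I" "j \<in> I" "i \<noteq> j"
  shows "exponents_bounded I (\<lambda>x. (if x = j then l else 0) + (if x = i then l else 0)) (pair_factor l i j)"
proof -
  have "lconst 1 = 1"
    by (simp add: lconst_def)
  then show ?thesis
    unfolding pair_factor_def
    using assms exponents_bounded_q_poch[of I i j l 1 q_indet] exponents_bounded_q_poch[of I j i l q_indet q_indet]
    by (intro exponents_bounded_mult) simp_all
qed

definition left_out_exponents :: "nat \<Rightarrow> nat \<Rightarrow> nat \<Rightarrow> nat \<Rightarrow> nat set" where
  "left_out_exponents n1 n0 k i = (if n0 < i then {} else (\<lambda>j. (n0 - 1 + j) * k + j) ` {1..<n1})"

definition node_exponents :: "nat \<Rightarrow> nat \<Rightarrow> nat \<Rightarrow> nat \<Rightarrow> nat set" where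
  "node_exponents n1 n0 k i = {0..(n0 + n1 - 1) * k + (n1 - 1)} - left_out_exponents n1 n0 k i"

lemma inj_left_out_exponent: "inj (\<lambda>j. (c + j) * k + (j :: nat))"
proof (rule strict_mono_imp_inj_on)
  show "strict_mono (\<lambda>j. (c + j) * k + j)"
    by (auto simp: strict_mono_def intro: add_le_less_mono)
qed

text \<open>Consequently the extremal point stays in the grid, and the nodes below it still form a
  full interval.\<close>

lemma left_out_exponent_bounds:
  assumes "n1 \<ge> 1" "i \<in> {1..n0+n1}" "a \<in> left_out_exponents n1 n0 k i"
  shows "a \<le> (n0 + n1 - 1) * k + (n1 - 1)" "extremal_point n0 k i < a"
proof -
  obtain j where j: "i \<le> n0" "j \<in> {1..<n1}" "a = (n0 - 1 + j) * k + j"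
    using assms by (auto simp: left_out_exponents_def split: if_splits)
  show "a \<le> (n0 + n1 - 1) * k + (n1 - 1)"
    unfolding j(3) using j assms by (intro add_mono mult_right_mono) auto
  have "(i - 1) * k \<le> (n0 - 1 + j) * k"
    using j by (intro mult_right_mono) auto
  moreover have "extremal_point n0 k i = (i - 1) * k" "0 < j"
    using j by (simp_all add: extremal_point_def)
  ultimately show "extremal_point n0 k i < a"
    unfolding j(3) by linarith
qed

lemma card_node_exponents:
  assumes "n1 \<ge> 1" "i \<in> {1..n0+n1}"
  shows "card (node_exponents n1 n0 k i) = Suc ((n0 + n1 - 1) * k + (if n0 < i then n1 - 1 else 0))"
proof (cases "n0 < i")
  case True
  then show ?thesis
    by (simp add: node_exponents_def left_out_exponents_def)
next
  case False
  have "card (left_out_exponents n1 n0 k i) = n1 - 1"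
    using False inj_left_out_exponent[of "n0 - 1" k] by (simp add: left_out_exponents_def card_image inj_on_subset)
  moreover have "left_out_exponents n1 n0 k i \<subseteq> {0..(n0 + n1 - 1) * k + (n1 - 1)}"
    using left_out_exponent_bounds[OF assms] by auto
  ultimately show ?thesis
    using False by (simp add: node_exponents_def card_Diff_subset left_out_exponents_def)
qed

text \<open>Smaller partners of \<open>x\<close> contribute their own multiplicity, larger ones that
  of \<open>x\<close>. For \<open>x > n0\<close> the excess over \<open>k\<close> per partner is
  \<open>x - 1 - n0\<close> from below and \<open>n0 + n1 - x\<close> from above, together
  \<open>n1 - 1\<close>. The bound is one less than the size in
  \<open>card_node_exponents\<close>.\<close>

lemma sum_pair_multiplicity:
  assumes "n1 \<ge> 1" "x \<in> {1..n0+n1}"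
  shows "(\<Sum>j\<in>{1..n0+n1}. \<Sum>i\<in>{1..<j}. (if x = j then pair_multiplicity n0 k i else 0) +
    (if x = i then pair_multiplicity n0 k i else 0)) \<le> (n0 + n1 - 1) * k + (if n0 < x then n1 - 1 else 0)"
proof -
  let ?m = "pair_multiplicity n0 k"
  have "(\<Sum>j\<in>{1..n0+n1}. \<Sum>i\<in>{1..<j}. (if x = j then ?m i else 0) + (if x = i then ?m i else 0)) =
      (\<Sum>j\<in>{1..n0+n1}. if x = j then \<Sum>i\<in>{1..<j}. ?m i else 0) +
      (\<Sum>j\<in>{1..n0+n1}. if x < j then ?m x else 0)"
    unfolding sum.distrib using assms by (intro arg_cong2[of _ _ _ _ "(+)"] sum.cong refl) auto
  also have "(\<Sum>j\<in>{1..n0+n1}. if x = j then \<Sum>i\<in>{1..<j}. ?m i else 0) = (\<Sum>i\<in>{1..<x}. ?m i)"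
    using assms by simp
  also have "(\<Sum>j\<in>{1..n0+n1}. if x < j then ?m x else 0) = (\<Sum>j\<in>{x<..n0+n1}. ?m x)"
    using assms by (intro sum.mono_neutral_cong_right) auto
  also have "(\<Sum>i\<in>{1..<x}. ?m i) = (x - 1) * k + (x - 1 - n0)"
  proof (induction x)
    case (Suc x)
    then show ?case
      by (cases x) (auto simp: pair_multiplicity_def)
  qed simp
  also have "(x - 1) * k + (x - 1 - n0) + (\<Sum>j\<in>{x<..n0+n1}. ?m x) =
      (x - 1 + (n0 + n1 - x)) * k + (x - 1 - n0 + (if n0 < x then n0 + n1 - x else 0))"
    by (simp add: pair_multiplicity_def add_mult_distrib)
  also have "\<dots> = (n0 + n1 - 1) * k + (if n0 < x then n1 - 1 else 0)"
    using assms by auto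
  finally show ?thesis by simp
qed

section \<open>Values on the grid and the surviving point\<close>

lemma laurent_eval_pair_factor:
  assumes "finite I" "i \<in> I" "j \<in> I" "\<And>x. x \<in> I \<Longrightarrow> c x = q_indet ^ \<alpha> x"
  shows "laurent_eval I c (pair_factor l i j) =
    (\<Prod>m<l. 1 - q_indet ^ (\<alpha> i + m) / q_indet ^ \<alpha> j) *
    (\<Prod>m<l. 1 - q_indet ^ (\<alpha> j + m + 1) / q_indet ^ \<alpha> i)"
proof -
  have nz: "0 \<notin> c ` I"
    using assms(4) by auto
  show ?thesis
    unfolding pair_factor_def laurent_eval_mult[OF nz] laurent_eval_q_poch[OF nz] laurent_eval_lconst
      laurent_eval_lz[OF assms(1,2)] laurent_eval_lz[OF assms(1,3)]
      laurent_eval_lz_inv[OF assms(1,2)] laurent_eval_lz_inv[OF assms(1,3)]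
    using assms by (simp add: q_poch_def divide_inverse power_add mult_ac)
qed

text \<open>The first product vanishes if \<open>a \<le> b < a + l\<close>, the second if
  \<open>b < a \<le> b + l\<close>. The extra \<open>q\<close> in the second symbol causes the
  asymmetry between weak and strict inequality.\<close>

lemma pair_factor_separation:
  assumes "(\<Prod>m<l. 1 - q_indet ^ (a + m) / q_indet ^ b) * (\<Prod>m<l. 1 - q_indet ^ (b + m + 1) / q_indet ^ a) \<noteq> 0"
  shows "a + l \<le> b \<or> b + l < a"
proof (rule ccontr)
  assume close: "\<not> ?thesis"
  then consider m where "m < l" "a + m = b" | m where "m < l" "b + m + 1 = a"
  proof -
    have "b - a < l \<and> a + (b - a) = b \<or> a - b - 1 < l \<and> b + (a - b - 1) + 1 = a"
      using close by linarith
    then show thesis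
      using that by blast
  qed
  then show False
  proof cases
    case 1
    then show ?thesis
      using assms by (auto simp: prod_zero_iff)
  next
    case 2
    then show ?thesis
      using assms by (auto simp: prod_zero_iff)
  qed
qed

lemma extremal_point_Suc:
  "i \<ge> 1 \<Longrightarrow> extremal_point n0 k (Suc i) = extremal_point n0 k i + pair_multiplicity n0 k i"
  by (cases i) (auto simp: extremal_point_def pair_multiplicity_def)

text \<open>By \<open>extremal_point_Suc\<close> the blocks of length
  \<open>pair_multiplicity n0 k i\<close> starting at the extremal exponents tile the interval below
  \<open>extremal_point n0 k j\<close>.\<close>

lemma prod_consecutive_blocks:
  fixes f :: "nat \<Rightarrow> 'a::comm_monoid_mult"
  assumes "j \<ge> 1"
  shows "(\<Prod>i\<in>{1..<j}. \<Prod>m<pair_multiplicity n0 k i. f (extremal_point n0 k i + m)) =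
    (\<Prod>a<extremal_point n0 k j. f a)"
  using assms
proof (induction j rule: dec_induct)
  case base
  then show ?case by (simp add: extremal_point_def)
next
  case (step j)
  have "(\<Prod>a<x + y. f a) = (\<Prod>a<x. f a) * (\<Prod>m<y. f (x + m))" for x y
    by (induction y) (simp_all add: mult_ac)
  then show ?case
    using step by (simp add: extremal_point_Suc)
qed

text \<open>What remains of the contribution of the \<open>i\<close>-th variable after cancellation:
  the second q-Pochhammer symbols of its pairs with larger indices, divided by the part of the
  inverse node weight from nodes above the extremal one.\<close>

definition site_factor :: "nat \<Rightarrow> nat \<Rightarrow> nat \<Rightarrow> nat \<Rightarrow> ratfun" where
  "site_factor n1 n0 k i =
    (\<Prod>j\<in>{i<..n0+n1}. q_poch q_indet q_indet (extremal_point n0 k j - extremal_point n0 k i + pair_multiplicity n0 k i) /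
        q_poch q_indet q_indet (extremal_point n0 k j - extremal_point n0 k i)) /
    (\<Prod>a\<in>node_exponents n1 n0 k i \<inter> {extremal_point n0 k i<..}. 1 - q_indet ^ (a - extremal_point n0 k i))"

lemma CT_eq_prod_site_factor:
  assumes "n1 \<ge> 1" "k \<ge> 1"
  shows "D1_00 n1 n0 k = (\<Prod>i\<in>{1..n0+n1}. site_factor n1 n0 k i)"
proof -
  let ?n = "n0 + n1"
  let ?q = "q_indet"
  let ?m = "pair_multiplicity n0 k"
  let ?\<epsilon> = "extremal_point n0 k"
  let ?M = "(?n - 1) * k + (n1 - 1)"
  define I where "I = {1..?n}"
  define C where "C i = (\<lambda>a. ?q ^ a) ` node_exponents n1 n0 k i" for i
  define L where "L = (\<Prod>j\<in>{1..?n}. \<Prod>i\<in>{1..<j}. pair_factor (?m i) i j)"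
  define p where "p = restrict (\<lambda>i. ?q ^ ?\<epsilon> i) I"
  have I: "finite I"
    by (simp add: I_def)
  have inj: "inj ((^) ?q)"
    by (auto simp: inj_on_def q_indet_power_eq_iff)
  have eval_L: "laurent_eval I c L = (\<Prod>j\<in>{1..?n}. \<Prod>i\<in>{1..<j}.
      (\<Prod>m<?m i. 1 - ?q ^ (\<alpha> i + m) / ?q ^ \<alpha> j) * (\<Prod>m<?m i. 1 - ?q ^ (\<alpha> j + m + 1) / ?q ^ \<alpha> i))"
    if c: "\<forall>i\<in>I. c i = ?q ^ \<alpha> i" for c \<alpha>
  proof -
    have nz: "0 \<notin> c ` I"
      using c by auto
    show ?thesis
      unfolding L_def laurent_eval_prod[OF nz]
      by (intro prod.cong refl laurent_eval_pair_factor I bspec[OF c]) (auto simp: I_def)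
  qed
  have mem: "?\<epsilon> i \<in> node_exponents n1 n0 k i" if "i \<in> I" for i
  proof -
    have "?\<epsilon> i \<le> ?M"
      unfolding extremal_point_def using that by (intro add_mono mult_right_mono) (auto simp: I_def)
    moreover have "?\<epsilon> i \<notin> left_out_exponents n1 n0 k i"
      using left_out_exponent_bounds(2)[OF assms(1), of i n0 "?\<epsilon> i" k] that by (auto simp: I_def)
    ultimately show ?thesis
      by (simp add: node_exponents_def)
  qed
  have p: "p \<in> PiE I C" "\<forall>i\<in>I. p i = ?q ^ ?\<epsilon> i"
    using mem by (auto simp: p_def C_def)
  have vanish: "laurent_eval I c L = 0" if c: "c \<in> PiE I C" "c \<noteq> p" for c
  proof (rule ccontr)
    assume nz: "laurent_eval I c L \<noteq> 0"
    have "\<forall>i\<in>I. \<exists>a. a \<in> node_exponents n1 n0 k i \<and> c i = ?q ^ a"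
      using c by (auto simp: C_def dest!: PiE_mem)
    then obtain \<alpha> where \<alpha>: "\<And>i. i \<in> I \<Longrightarrow> \<alpha> i \<in> node_exponents n1 n0 k i"
      "\<forall>i\<in>I. c i = ?q ^ \<alpha> i"
      by metis
    have "\<alpha> i = ?\<epsilon> i" if "i \<in> {1..?n}" for i
    proof (rule separated_exponents_unique[OF assms refl _ _ _ that])
      show "\<alpha> i \<le> ?M" if "i \<in> {1..?n}" for i
        using \<alpha>(1)[of i] that by (auto simp: I_def node_exponents_def)
      show "\<alpha> i \<noteq> (n0 - 1 + j) * k + j" if "i \<in> {1..n0}" "j \<in> {1..<n1}" for i j
        using \<alpha>(1)[of i] that by (auto simp: I_def node_exponents_def left_out_exponents_def)
      show "\<alpha> i + (if n0 < i then k + 1 else k) \<le> \<alpha> j \<or> \<alpha> j + (if n0 < i then k + 1 else k) < \<alpha> i"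
        if "1 \<le> i" "i < j" "j \<le> ?n" for i j
        unfolding pair_multiplicity_def[symmetric]
      proof (rule pair_factor_separation)
        show "(\<Prod>m<?m i. 1 - ?q ^ (\<alpha> i + m) / ?q ^ \<alpha> j) * (\<Prod>m<?m i. 1 - ?q ^ (\<alpha> j + m + 1) / ?q ^ \<alpha> i) \<noteq> 0"
        proof
          assume zero: "(\<Prod>m<?m i. 1 - ?q ^ (\<alpha> i + m) / ?q ^ \<alpha> j) * (\<Prod>m<?m i. 1 - ?q ^ (\<alpha> j + m + 1) / ?q ^ \<alpha> i) = 0"
          have "laurent_eval I c L = 0"
            unfolding eval_L[OF \<alpha>(2)]
          proof (rule prod_zero)
            show "\<exists>j\<in>{1..?n}. (\<Prod>i\<in>{1..<j}. (\<Prod>m<?m i. 1 - ?q ^ (\<alpha> i + m) / ?q ^ \<alpha> j) *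
                (\<Prod>m<?m i. 1 - ?q ^ (\<alpha> j + m + 1) / ?q ^ \<alpha> i)) = 0"
              using that zero by (intro bexI[of _ j] prod_zero bexI[of _ i]) auto
          qed simp
          with nz show False ..
        qed
      qed
    qed
    then have "c = p"
      using c(1) \<alpha>(2) by (auto simp: p_def I_def fun_eq_iff restrict_def PiE_def extensional_def)
    with c(2) show False ..
  qed
  have bounded: "exponents_bounded I (\<lambda>i. (?n - 1) * k + (if n0 < i then n1 - 1 else 0)) L"
  proof -
    have b: "exponents_bounded I (\<lambda>x. \<Sum>j\<in>{1..?n}. \<Sum>i\<in>{1..<j}.
        (if x = j then ?m i else 0) + (if x = i then ?m i else 0)) L"
      unfolding L_def
      by (intro exponents_bounded_prod exponents_bounded_pair_factor I) (auto simp: I_def)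
    show ?thesis
      unfolding exponents_bounded_def
    proof (intro ballI conjI allI impI)
      fix e x assume e: "e \<in> Poly_Mapping.keys L"
      \<comment> \<open>The bound is demanded for every variable, but
        \<open>sum_pair_multiplicity\<close> only covers indices in \<open>I\<close>; outside
        \<open>I\<close> the exponent is 0.\<close>
      show "- int ((?n - 1) * k + (if n0 < x then n1 - 1 else 0)) \<le> Poly_Mapping.lookup e x"
      proof (cases "x \<in> I")
        case True
        have "- int (\<Sum>j\<in>{1..?n}. \<Sum>i\<in>{1..<j}.
            (if x = j then ?m i else 0) + (if x = i then ?m i else 0)) \<le> Poly_Mapping.lookup e x"
          using b e unfolding exponents_bounded_def by blast
        moreover have "(\<Sum>j\<in>{1..?n}. \<Sum>i\<in>{1..<j}.
            (if x = j then ?m i else 0) + (if x = i then ?m i else 0)) \<le>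
            (?n - 1) * k + (if n0 < x then n1 - 1 else 0)"
          using True unfolding I_def by (rule sum_pair_multiplicity[OF assms(1)])
        ultimately show ?thesis
          by linarith
      next
        case False
        then have "Poly_Mapping.lookup e x = 0"
          using b e unfolding exponents_bounded_def by blast
        then show ?thesis
          by (simp only: neg_le_0_iff_le of_nat_0_le_iff)
      qed
    qed (use b in \<open>unfold exponents_bounded_def, blast+\<close>)
  qed
  have fin_C: "finite (C i)" for i
    by (simp add: C_def node_exponents_def)
  have "D1_00 n1 n0 k = CT L"
    by (simp add: D1_00_eq_CT L_def)
  also have "\<dots> = (\<Sum>c\<in>PiE I C. (\<Prod>i\<in>I. node_weight (C i) (c i)) * laurent_eval I c L)"
  proof (rule CT_eq_sum_over_grid[OF I _ bounded])
    show "finite (C i) \<and> 0 \<notin> C i \<and> card (C i) = Suc ((?n - 1) * k + (if n0 < i then n1 - 1 else 0))"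
      if "i \<in> I" for i
      using that card_node_exponents[OF assms(1), of i n0 k] inj fin_C
      by (auto simp: C_def I_def card_image inj_on_subset)
  qed
  also have "\<dots> = (\<Sum>c\<in>{p}. (\<Prod>i\<in>I. node_weight (C i) (c i)) * laurent_eval I c L)"
    using p(1) vanish fin_C I by (intro sum.mono_neutral_right) (auto intro!: finite_PiE)
  also have "\<dots> = (\<Prod>i\<in>I. node_weight (C i) (p i)) * laurent_eval I p L"
    by simp
  also have "laurent_eval I p L = (\<Prod>j\<in>I. \<Prod>a<?\<epsilon> j. 1 - ?q ^ a / ?q ^ ?\<epsilon> j) *
      (\<Prod>j\<in>I. \<Prod>i\<in>{1..<j}. \<Prod>m<?m i. 1 - ?q ^ (?\<epsilon> j + m + 1) / ?q ^ ?\<epsilon> i)"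
    unfolding eval_L[OF p(2)] unfolding prod.distrib I_def
    by (intro arg_cong2[of _ _ _ _ "(*)"] prod.cong refl prod_consecutive_blocks) auto
  \<comment> \<open>Exchanging the products groups the second symbols by the smaller index, as in
    \<open>site_factor\<close>.\<close>
  also have "(\<Prod>j\<in>I. \<Prod>i\<in>{1..<j}. \<Prod>m<?m i. 1 - ?q ^ (?\<epsilon> j + m + 1) / ?q ^ ?\<epsilon> i) =
      (\<Prod>i\<in>I. \<Prod>j\<in>{i<..?n}. \<Prod>m<?m i. 1 - ?q ^ (?\<epsilon> j + m + 1) / ?q ^ ?\<epsilon> i)"
    unfolding I_def by (rule trans[OF prod_pairs_eq(1)[symmetric] prod_pairs_eq(2)])
  also have "\<dots> = (\<Prod>i\<in>I. \<Prod>j\<in>{i<..?n}. q_poch ?q ?q (?\<epsilon> j - ?\<epsilon> i + ?m i) / q_poch ?q ?q (?\<epsilon> j - ?\<epsilon> i))"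
  proof (intro prod.cong refl)
    fix i j assume "i \<in> I" "j \<in> {i<..?n}"
    then have le: "?\<epsilon> i \<le> ?\<epsilon> j"
      unfolding extremal_point_def by (intro add_mono mult_right_mono) auto
    have "(\<Prod>m<?m i. 1 - ?q ^ (?\<epsilon> j + m + 1) / ?q ^ ?\<epsilon> i) = (\<Prod>m<?m i. 1 - ?q ^ (?\<epsilon> j - ?\<epsilon> i + m + 1))"
    proof (intro prod.cong refl)
      fix m
      have "?q ^ (?\<epsilon> j + m + 1) = ?q ^ (?\<epsilon> j - ?\<epsilon> i + m + 1) * ?q ^ ?\<epsilon> i"
        using le by (simp flip: power_add)
      then show "1 - ?q ^ (?\<epsilon> j + m + 1) / ?q ^ ?\<epsilon> i = 1 - ?q ^ (?\<epsilon> j - ?\<epsilon> i + m + 1)"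
        by simp
    qed
    then show "(\<Prod>m<?m i. 1 - ?q ^ (?\<epsilon> j + m + 1) / ?q ^ ?\<epsilon> i) =
        q_poch ?q ?q (?\<epsilon> j - ?\<epsilon> i + ?m i) / q_poch ?q ?q (?\<epsilon> j - ?\<epsilon> i)"
      using P_nonzero[OF q_indet_power_neq_1, of "?\<epsilon> j - ?\<epsilon> i"]
        q_poch_shift[of ?q "?\<epsilon> j - ?\<epsilon> i" "?m i"]
      by (simp add: eq_divide_eq mult.commute)
  qed
  also have "(\<Prod>i\<in>I. node_weight (C i) (p i)) =
      inverse ((\<Prod>j\<in>I. \<Prod>a<?\<epsilon> j. 1 - ?q ^ a / ?q ^ ?\<epsilon> j) *
        (\<Prod>i\<in>I. \<Prod>a\<in>node_exponents n1 n0 k i \<inter> {?\<epsilon> i<..}. 1 - ?q ^ (a - ?\<epsilon> i)))"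
    unfolding prod.distrib[symmetric] prod_inversef[symmetric] o_def
  proof (intro prod.cong refl)
    fix i assume i: "i \<in> I"
    let ?E = "node_exponents n1 n0 k i"
    \<comment> \<open>Everything left out lies above the extremal exponent, so all smaller exponents
      are nodes. Their part of the weight is inverse to the tiled product in the value of
      \<open>L\<close>.\<close>
    have E: "?E - {?\<epsilon> i} = {..<?\<epsilon> i} \<union> (?E \<inter> {?\<epsilon> i<..})"
      using mem[OF i] left_out_exponent_bounds[OF assms(1), of i n0 _ k] i by (fastforce simp: node_exponents_def I_def)
    have "C i - {p i} = (\<lambda>a. ?q ^ a) ` (?E - {?\<epsilon> i})"
      using i by (auto simp: C_def p(2) q_indet_power_eq_iff)
    then have "(\<Prod>y\<in>C i - {p i}. 1 - y / p i) = (\<Prod>a\<in>?E - {?\<epsilon> i}. 1 - ?q ^ a / ?q ^ ?\<epsilon> i)"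
      using i by (simp add: prod.reindex[OF inj_on_subset[OF inj]] p(2))
    also have "\<dots> = (\<Prod>a<?\<epsilon> i. 1 - ?q ^ a / ?q ^ ?\<epsilon> i) * (\<Prod>a\<in>?E \<inter> {?\<epsilon> i<..}. 1 - ?q ^ a / ?q ^ ?\<epsilon> i)"
      unfolding E by (subst prod.union_disjoint) (auto simp: node_exponents_def)
    also have "(\<Prod>a\<in>?E \<inter> {?\<epsilon> i<..}. 1 - ?q ^ a / ?q ^ ?\<epsilon> i) = (\<Prod>a\<in>?E \<inter> {?\<epsilon> i<..}. 1 - ?q ^ (a - ?\<epsilon> i))"
      by (intro prod.cong refl) (auto simp: power_diff)
    finally show "node_weight (C i) (p i) = inverse ((\<Prod>a<?\<epsilon> i. 1 - ?q ^ a / ?q ^ ?\<epsilon> i) *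
        (\<Prod>a\<in>?E \<inter> {?\<epsilon> i<..}. 1 - ?q ^ (a - ?\<epsilon> i)))"
      by (simp add: node_weight_def)
  qed
  finally have eq: "D1_00 n1 n0 k = inverse ((\<Prod>j\<in>I. \<Prod>a<?\<epsilon> j. 1 - ?q ^ a / ?q ^ ?\<epsilon> j) *
        (\<Prod>i\<in>I. \<Prod>a\<in>node_exponents n1 n0 k i \<inter> {?\<epsilon> i<..}. 1 - ?q ^ (a - ?\<epsilon> i))) *
      ((\<Prod>j\<in>I. \<Prod>a<?\<epsilon> j. 1 - ?q ^ a / ?q ^ ?\<epsilon> j) *
        (\<Prod>i\<in>I. \<Prod>j\<in>{i<..?n}. q_poch ?q ?q (?\<epsilon> j - ?\<epsilon> i + ?m i) / q_poch ?q ?q (?\<epsilon> j - ?\<epsilon> i)))" .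
  have "(\<Prod>j\<in>I. \<Prod>a<?\<epsilon> j. 1 - ?q ^ a / ?q ^ ?\<epsilon> j) \<noteq> 0"
    by (auto simp: I q_indet_power_eq_iff)
  then show ?thesis
    unfolding eq site_factor_def prod_dividef[where A = "{1..?n}"] by (simp add: I_def divide_inverse)
qed

section \<open>Closed forms of the site factors\<close>

lemma prod_greaterThanAtMost_shift:
  fixes f :: "nat \<Rightarrow> 'a::comm_monoid_mult"
  shows "(\<Prod>a\<in>{x<..y}. f a) = (\<Prod>l<y - x. f (x + l + 1))"
  by (rule prod.reindex_bij_witness[of _ "\<lambda>l. x + l + 1" "\<lambda>a. a - x - 1"]) auto

lemma q_poch_eq_prod: "q_poch q q r = (\<Prod>l<r. 1 - q ^ (l + 1))"
  using q_poch_shift[of q 0 r] by simp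

lemma prod_q_poch_ratio_telescope:
  fixes q :: "'a::field"
  assumes "\<And>m. m > 0 \<Longrightarrow> q ^ m \<noteq> 1"
  shows "(\<Prod>t<r. q_poch q q (Suc t * s + s) / q_poch q q (Suc t * s)) = q_poch q q (Suc r * s) / q_poch q q s"
  using prod_lessThan_telescope[of r "\<lambda>t. q_poch q q (Suc t * s)"] P_nonzero[OF assms]
  by (simp add: add.commute)

text \<open>From \<open>i\<close> onwards the extremal exponents form an arithmetic progression with
  difference \<open>k + 1\<close>, so the quotients telescope. No node is left out, hence the
  denominator is a full q-factorial product.\<close>

lemma site_factor_late:
  assumes "i \<in> {n0<..n0+n1}"
  shows "site_factor n1 n0 k i = late_factor q_indet k (n0 + n1 - i)"
proof -
  let ?n = "n0 + n1"
  let ?P = "q_poch q_indet q_indet"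
  let ?\<epsilon> = "extremal_point n0 k"
  obtain s where s: "i = Suc (n0 + s)"
    using assms by (auto simp: less_iff_Suc_add)
  have diff: "?\<epsilon> (i + t) - ?\<epsilon> i = t * (k + 1)" for t
    by (simp add: s extremal_point_def algebra_simps)
  have "(\<Prod>j\<in>{i<..?n}. ?P (?\<epsilon> j - ?\<epsilon> i + pair_multiplicity n0 k i) / ?P (?\<epsilon> j - ?\<epsilon> i)) =
      (\<Prod>t<?n - i. ?P (Suc t * (k + 1) + (k + 1)) / ?P (Suc t * (k + 1)))"
    unfolding prod_greaterThanAtMost_shift
    using diff[of "Suc t" for t] assms by (simp add: pair_multiplicity_def)
  also have "\<dots> = ?P (Suc (?n - i) * (k + 1)) / ?P (k + 1)"
    by (rule prod_q_poch_ratio_telescope) (rule q_indet_power_neq_1)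
  finally have num: "(\<Prod>j\<in>{i<..?n}. ?P (?\<epsilon> j - ?\<epsilon> i + pair_multiplicity n0 k i) / ?P (?\<epsilon> j - ?\<epsilon> i)) =
      ?P (Suc (?n - i) * (k + 1)) / ?P (k + 1)" .
  have "node_exponents n1 n0 k i \<inter> {?\<epsilon> i<..} = {?\<epsilon> i<..(?n - 1) * k + (n1 - 1)}"
    using assms by (auto simp: node_exponents_def left_out_exponents_def)
  moreover have "(?n - 1) * k + (n1 - 1) - ?\<epsilon> i = (?n - i) * (k + 1)"
  proof -
    have "(?n - 1) * k + (n1 - 1) = ?\<epsilon> (i + (?n - i))"
      using assms by (simp add: extremal_point_def)
    then show ?thesis
      using diff[of "?n - i"] by simp
  qed
  ultimately have "(\<Prod>a\<in>node_exponents n1 n0 k i \<inter> {?\<epsilon> i<..}. 1 - q_indet ^ (a - ?\<epsilon> i)) =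
      ?P ((?n - i) * (k + 1))"
    by (simp add: prod_greaterThanAtMost_shift q_poch_eq_prod del: mult_Suc_right)
  then show ?thesis
    unfolding site_factor_def num late_factor_def by simp
qed

text \<open>Partners up to \<open>n0\<close> lie at multiples of \<open>k\<close> and telescope;
  later partners give the profile quotients. The denominator runs over a full interval except for
  the left-out exponents, whose factors move to the numerator.\<close>

lemma site_factor_early:
  assumes "n1 \<ge> 1" "i \<in> {1..n0}"
  shows "site_factor n1 n0 k i = early_factor q_indet n1 k (n0 - i)"
proof -
  let ?n = "n0 + n1"
  let ?P = "q_poch q_indet q_indet"
  let ?\<epsilon> = "extremal_point n0 k"
  let ?M = "(?n - 1) * k + (n1 - 1)"
  obtain u where u: "n0 = i + u"
    using assms by (auto simp: le_iff_add)
  obtain i' where i': "i = Suc i'"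
    using assms by (cases i) auto
  have eps: "?\<epsilon> i = i' * k"
    by (simp add: extremal_point_def u i')
  have diff_early: "?\<epsilon> (i + t) - ?\<epsilon> i = t * k" if "t \<le> u" for t
    using that by (simp add: extremal_point_def u i' algebra_simps)
  have diff_late: "?\<epsilon> (Suc (n0 + v)) - ?\<epsilon> i = profile k (Suc u) v" for v
    by (simp add: extremal_point_def profile_def u i' algebra_simps)
  have "(\<Prod>j\<in>{i<..n0}. ?P (?\<epsilon> j - ?\<epsilon> i + k) / ?P (?\<epsilon> j - ?\<epsilon> i)) =
      (\<Prod>t<u. ?P (Suc t * k + k) / ?P (Suc t * k))"
    unfolding prod_greaterThanAtMost_shift
    using diff_early[of "Suc t" for t] by (intro prod.cong) (auto simp: u)
  also have "\<dots> = ?P (Suc u * k) / ?P k"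
    by (rule prod_q_poch_ratio_telescope) (rule q_indet_power_neq_1)
  finally have early: "(\<Prod>j\<in>{i<..n0}. ?P (?\<epsilon> j - ?\<epsilon> i + k) / ?P (?\<epsilon> j - ?\<epsilon> i)) = ?P (Suc u * k) / ?P k" .
  have late: "(\<Prod>j\<in>{n0<..?n}. ?P (?\<epsilon> j - ?\<epsilon> i + k) / ?P (?\<epsilon> j - ?\<epsilon> i)) =
      (\<Prod>v<n1. ?P (profile k (Suc u) v + k) / ?P (profile k (Suc u) v))"
    unfolding prod_greaterThanAtMost_shift by (simp add: diff_late)
  have "{i<..?n} = {i<..n0} \<union> {n0<..?n}"
    using assms by auto
  then have num: "(\<Prod>j\<in>{i<..?n}. ?P (?\<epsilon> j - ?\<epsilon> i + pair_multiplicity n0 k i) / ?P (?\<epsilon> j - ?\<epsilon> i)) =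
      ?P (Suc u * k) / ?P k * (\<Prod>v<n1. ?P (profile k (Suc u) v + k) / ?P (profile k (Suc u) v))"
    using assms unfolding early[symmetric] late[symmetric]
    by (simp add: pair_multiplicity_def prod.union_disjoint ivl_disj_int)
  let ?R = "left_out_exponents n1 n0 k i"
  have R: "?R \<subseteq> {?\<epsilon> i<..?M}"
    using left_out_exponent_bounds[OF assms(1), of i n0 _ k] assms(2) by auto
  have "(\<Prod>a\<in>?R. 1 - q_indet ^ (a - ?\<epsilon> i)) =
      (\<Prod>j\<in>{1..<n1}. 1 - q_indet ^ ((n0 - 1 + j) * k + j - ?\<epsilon> i))"
    using assms prod.reindex[OF inj_on_subset[OF inj_left_out_exponent[of "n0 - 1" k]], of "{1..<n1}"]
    by (simp add: left_out_exponents_def o_def)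
  \<comment> \<open>With \<open>j = v + 1\<close>, the left-out exponent exceeds the extremal one by
    \<open>Suc (profile k (Suc u) v)\<close>.\<close>
  also have "\<dots> = (\<Prod>v<n1 - 1. 1 - q_indet ^ Suc (profile k (Suc u) v))"
    unfolding eps
    by (rule prod.reindex_bij_witness[of _ Suc "\<lambda>j. j - 1"])
      (auto simp: profile_def u i' algebra_simps)
  finally have R_prod: "(\<Prod>a\<in>?R. 1 - q_indet ^ (a - ?\<epsilon> i)) =
      (\<Prod>v<n1 - 1. 1 - q_indet ^ Suc (profile k (Suc u) v))" .
  have M: "?M - ?\<epsilon> i = profile k (Suc u) (n1 - 1)"
    using diff_late[of "n1 - 1"] assms by (simp add: extremal_point_def)
  have "node_exponents n1 n0 k i \<inter> {?\<epsilon> i<..} = {?\<epsilon> i<..?M} - ?R"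
    by (auto simp: node_exponents_def)
  then have "(\<Prod>a\<in>node_exponents n1 n0 k i \<inter> {?\<epsilon> i<..}. 1 - q_indet ^ (a - ?\<epsilon> i)) *
      (\<Prod>a\<in>?R. 1 - q_indet ^ (a - ?\<epsilon> i)) = (\<Prod>a\<in>{?\<epsilon> i<..?M}. 1 - q_indet ^ (a - ?\<epsilon> i))"
    by (simp only: prod.subset_diff[OF R finite_greaterThanAtMost])
  also have "\<dots> = ?P (profile k (Suc u) (n1 - 1))"
    unfolding prod_greaterThanAtMost_shift M q_poch_eq_prod by simp
  finally have den: "(\<Prod>a\<in>node_exponents n1 n0 k i \<inter> {?\<epsilon> i<..}. 1 - q_indet ^ (a - ?\<epsilon> i)) *
      (\<Prod>v<n1 - 1. 1 - q_indet ^ Suc (profile k (Suc u) v)) = ?P (profile k (Suc u) (n1 - 1))"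
    unfolding R_prod .
  \<comment> \<open>Nonvanishing of \<open>p\<close> forces both \<open>x\<close> and
    \<open>r\<close> to be nonzero, so no separate argument for the left-out factors is
    required.\<close>
  have inverse_eq: "inverse x = r / p" if "x * r = p" "p \<noteq> 0" for x r p :: ratfun
    using that by (auto simp: inverse_eq_divide)
  have "?P (profile k (Suc u) (n1 - 1)) \<noteq> 0"
    by (rule P_nonzero) (rule q_indet_power_neq_1)
  note inverse_eq[OF den this]
  then show ?thesis
    unfolding site_factor_def num early_factor_def
    by (simp add: u divide_inverse mult.assoc)
qed

theorem theorem10:
  fixes n0 n1 k n :: nat
  assumes "n1 \<ge> 1" and "k \<ge> 1" and "n = n0 + n1"
  shows "D1_00 n1 n0 k =
    q_Gamma (q_indet ^ (k + 1)) (n1 + 1) / q_Gamma q_indet (1 + k) ^ n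
    * (\<Prod>j = 0..<n1. q_Gamma q_indet ((k + 1) * (j + 1) + k * n0)
                    / q_Gamma q_indet ((k + 1) * j + k * n0 + 1))
    * (\<Prod>l = 0..<n0. q_Gamma q_indet (1 + k * (l + 1)) / q_Gamma q_indet (1 + k * l))"
proof -
  have "{1..n0+n1} = {1..n0} \<union> {n0<..n0+n1}"
    by auto
  then have "D1_00 n1 n0 k = (\<Prod>i\<in>{1..n0}. site_factor n1 n0 k i) * (\<Prod>i\<in>{n0<..n0+n1}. site_factor n1 n0 k i)"
    unfolding CT_eq_prod_site_factor[OF assms(1,2)] by (simp add: prod.union_disjoint ivl_disj_int)
  also have "(\<Prod>i\<in>{1..n0}. site_factor n1 n0 k i) = (\<Prod>u<n0. early_factor q_indet n1 k u)"
    by (rule prod.reindex_bij_witness[of _ "\<lambda>u. n0 - u" "\<lambda>i. n0 - i"])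
      (auto simp: site_factor_early[OF assms(1)])
  also have "(\<Prod>i\<in>{n0<..n0+n1}. site_factor n1 n0 k i) = (\<Prod>s<n1. late_factor q_indet k s)"
    by (rule prod.reindex_bij_witness[of _ "\<lambda>s. n0 + n1 - s" "\<lambda>i. n0 + n1 - i"])
      (auto simp: site_factor_late)
  finally show ?thesis
    unfolding assms(3) using prod_factors_eq[OF q_indet_power_neq_1 assms(1)] by (simp add: mult.commute)
qed

end
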